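(* The order of an ordered group is an interval order if and only if it is a semiorder.
   Context: Groups are written additively but are not assumed abelian. An ordered group $G=(X,+,\leq)$ is a group with a partial order $\leq$ compatible with the group operation, i.e. preserved by all left and right translations. For positive integers $r,s$, $r\oplus s$ denotes the disjoint union of an $r$-element chain and an $s$-element chain, with every element of one incomparable to every element of the other. A poset $P$ embeds into a poset $P'$ if there is a one-to-one map $f$ with $f(x)\leq f(y)$ if and only if $x\leq y$. An order is an interval order if it does not embed $2\oplus 2$; it is a semiorder if it embeds neither $2\oplus 2$ nor $3\oplus 1$. *)

theory Defs
  imports Main
begin

(* The library classes of ordered groups presuppose commutativity; this one does not. *)
class ordered_group = group_add + order +
  assumes left_translation_mono: "x \<le> y \<Longrightarrow> z + x \<le> z + y"
    and right_translation_mono: "x \<le> y \<Longrightarrow> x + z \<le> y + z"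

(* A poset is given by a carrier set together with a relation, relevant only on that carrier. *)
definition embeds_into ::
  "'a set \<Rightarrow> ('a \<Rightarrow> 'a \<Rightarrow> bool) \<Rightarrow> 'b set \<Rightarrow> ('b \<Rightarrow> 'b \<Rightarrow> bool) \<Rightarrow> bool"
  where "embeds_into A leA B leB \<longleftrightarrow>
    (\<exists>f. inj_on f A \<and> f ` A \<subseteq> B \<and> (\<forall>x\<in>A. \<forall>y\<in>A. leB (f x) (f y) \<longleftrightarrow> leA x y))"

definition chain_sum :: "nat \<Rightarrow> nat \<Rightarrow> (nat + nat) set"
  where "chain_sum r s = {..<r} <+> {..<s}"

fun chain_sum_le :: "nat + nat \<Rightarrow> nat + nat \<Rightarrow> bool"
  where
    "chain_sum_le (Inl i) (Inl j) \<longleftrightarrow> i \<le> j"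
  | "chain_sum_le (Inr i) (Inr j) \<longleftrightarrow> i \<le> j"
  | "chain_sum_le (Inl _) (Inr _) \<longleftrightarrow> False"
  | "chain_sum_le (Inr _) (Inl _) \<longleftrightarrow> False"

definition interval_order_on :: "'a set \<Rightarrow> ('a \<Rightarrow> 'a \<Rightarrow> bool) \<Rightarrow> bool"
  where "interval_order_on A le \<longleftrightarrow> \<not> embeds_into (chain_sum 2 2) chain_sum_le A le"

definition semiorder_on :: "'a set \<Rightarrow> ('a \<Rightarrow> 'a \<Rightarrow> bool) \<Rightarrow> bool"
  where "semiorder_on A le \<longleftrightarrow>
    \<not> embeds_into (chain_sum 2 2) chain_sum_le A le \<and>
    \<not> embeds_into (chain_sum 3 1) chain_sum_le A le"

end

theory Submission
  imports Defs
begin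

text \<open>
  A semiorder is an interval order by definition, so the content lies in the converse: the order
  of an ordered group that embeds \<open>3 \<oplus> 1\<close> also embeds \<open>2 \<oplus> 2\<close>. Let \<open>a < b < c\<close> be a chain all of
  whose elements are incomparable to \<open>d\<close>. The translation by \<open>b - a\<close> on the left moves
  every element strictly upwards, because \<open>a < b\<close> makes \<open>b - a\<close> positive. In particular it moves
  \<open>d\<close> to \<open>(b - a) + d > d\<close>, and it moves \<open>a\<close> to \<open>b\<close>.
  Consequently the two-element chains \<open>b < c\<close> and \<open>d < (b - a) + d\<close> form a copy of \<open>2 \<oplus> 2\<close>:
  \<open>b < (b - a) + d\<close> is the translate of \<open>a < d\<close>, which fails, and \<open>d < c\<close> fails by assumption.
  By \<open>interval_order_chain_comparable\<close>, the failure of these two inequalities suffices.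
\<close>

text \<open>
  Two chains \<open>x < y\<close> and \<open>u < v\<close> form a copy of \<open>2 \<oplus> 2\<close> as soon as the bottom of neither lies
  below the top of the other, since a comparability between any two elements of different chains
  yields one of these two by transitivity.
\<close>
lemma interval_order_chain_comparable:
  fixes x y u v :: "'a::order"
  assumes interval: "interval_order_on UNIV ((\<le>) :: 'a \<Rightarrow> 'a \<Rightarrow> bool)"
    and "x < y" and "u < v"
  shows "x < v \<or> u < y"
proof (rule ccontr)
  assume "\<not> (x < v \<or> u < y)"
  then have "\<not> x < v" and "\<not> u < y" by auto
  have incomparable:
    "\<not> x \<le> u" "\<not> u \<le> x" "\<not> x \<le> v" "\<not> v \<le> x" "\<not> y \<le> u" "\<not> u \<le> y" "\<not> y \<le> v" "\<not> v \<le> y"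
    using \<open>x < y\<close> \<open>u < v\<close> \<open>\<not> x < v\<close> \<open>\<not> u < y\<close>
    by (metis le_less less_trans)+
  define f where
    "f = case_sum (\<lambda>i. if i = (0::nat) then x else y) (\<lambda>i. if i = (0::nat) then u else v)"
  have carrier: "chain_sum 2 2 = {Inl 0, Inl 1, Inr 0, Inr 1}"
    by (auto simp: chain_sum_def Plus_def numeral_2_eq_2 lessThan_Suc)
  have "inj_on f (chain_sum 2 2)"
    using \<open>x < y\<close> \<open>u < v\<close> incomparable unfolding carrier f_def by (auto simp: inj_on_def)
  moreover have "\<forall>s\<in>chain_sum 2 2. \<forall>t\<in>chain_sum 2 2. f s \<le> f t \<longleftrightarrow> chain_sum_le s t"
    using \<open>x < y\<close> \<open>u < v\<close> incomparable unfolding carrier f_def by (auto simp: less_le_not_le)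
  ultimately have "embeds_into (chain_sum 2 2) chain_sum_le UNIV ((\<le>) :: 'a \<Rightarrow> 'a \<Rightarrow> bool)"
    unfolding embeds_into_def by blast
  with interval show False
    by (simp add: interval_order_on_def)
qed

lemma embeds_three_plus_oneE:
  assumes "embeds_into (chain_sum 3 1) chain_sum_le UNIV ((\<le>) :: 'a::order \<Rightarrow> 'a::order \<Rightarrow> bool)"
  obtains a b c d :: "'a::order"
  where "a < b" "b < c" "\<not> a \<le> d" "\<not> d \<le> c"
proof -
  obtain f :: "nat + nat \<Rightarrow> 'a" where
    f: "\<forall>s\<in>chain_sum 3 1. \<forall>t\<in>chain_sum 3 1. f s \<le> f t \<longleftrightarrow> chain_sum_le s t"
    using assms unfolding embeds_into_def by blast
  have "Inl 0 \<in> chain_sum 3 1" "Inl 1 \<in> chain_sum 3 1" "Inl 2 \<in> chain_sum 3 1"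
    "Inr 0 \<in> chain_sum 3 1"
    by (auto simp: chain_sum_def)
  with f show thesis
    by (intro that[of "f (Inl 0)" "f (Inl 1)" "f (Inl 2)" "f (Inr 0)"]) (auto simp: less_le_not_le)
qed

lemma left_translation_le_iff:
  fixes x y z :: "'a::ordered_group"
  shows "z + x \<le> z + y \<longleftrightarrow> x \<le> y"
  using left_translation_mono[of "z + x" "z + y" "- z"] left_translation_mono[of x y z]
  by (auto simp flip: add.assoc)

lemma right_translation_le_iff:
  fixes x y z :: "'a::ordered_group"
  shows "x + z \<le> y + z \<longleftrightarrow> x \<le> y"
  using right_translation_mono[of "x + z" "y + z" "- z"] right_translation_mono[of x y z]
  by (auto simp: add.assoc)

text \<open>
  Right translations turn \<open>a < b\<close> into \<open>d < (b - a) + d\<close>, a two-element chain to compare with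
  \<open>b < c\<close>. If \<open>b\<close> lies below its top, cancelling \<open>b - a\<close> on the left gives \<open>a < d\<close>.
\<close>
lemma interval_ordered_group_no_three_plus_one:
  fixes a b c d :: "'a::ordered_group"
  assumes interval: "interval_order_on UNIV ((\<le>) :: 'a \<Rightarrow> 'a \<Rightarrow> bool)"
    and "a < b" and "b < c"
  shows "a \<le> d \<or> d \<le> c"
proof -
  define g where "g = b - a"
  have "g + a = b"
    by (simp add: g_def)
  have "0 + a < g + a"
    using \<open>a < b\<close> \<open>g + a = b\<close> by simp
  then have "0 + d < g + d"
    unfolding less_le_not_le right_translation_le_iff .
  then have "b < g + d \<or> d < c"
    using interval_order_chain_comparable[OF interval \<open>b < c\<close>] by simp
  moreover have "a \<le> d" if "b < g + d"
    using that \<open>g + a = b\<close> left_translation_le_iff[of g a d] by (simp add: less_imp_le)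
  ultimately show ?thesis
    by auto
qed

theorem corollary5:
  shows "interval_order_on UNIV ((\<le>) :: 'a::ordered_group \<Rightarrow> 'a \<Rightarrow> bool) \<longleftrightarrow>
    semiorder_on UNIV ((\<le>) :: 'a \<Rightarrow> 'a \<Rightarrow> bool)"
proof
  assume interval: "interval_order_on UNIV ((\<le>) :: 'a \<Rightarrow> 'a \<Rightarrow> bool)"
  have "\<not> embeds_into (chain_sum 3 1) chain_sum_le UNIV ((\<le>) :: 'a \<Rightarrow> 'a \<Rightarrow> bool)"
    using interval_ordered_group_no_three_plus_one[OF interval]
    by (blast elim: embeds_three_plus_oneE)
  with interval show "semiorder_on UNIV ((\<le>) :: 'a \<Rightarrow> 'a \<Rightarrow> bool)"
    by (simp add: interval_order_on_def semiorder_on_def)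
next
  assume "semiorder_on UNIV ((\<le>) :: 'a \<Rightarrow> 'a \<Rightarrow> bool)"
  then show "interval_order_on UNIV ((\<le>) :: 'a \<Rightarrow> 'a \<Rightarrow> bool)"
    by (simp add: interval_order_on_def semiorder_on_def)
qed

end
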